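(* There exist absolute constants $c,C>0$ and $n_0$ such that for all $n\ge n_0$, $\delta\in(0,1/2]$ and $\varepsilon\in(0,1]$ with $\varepsilon\ge c\sqrt{\log n\log(1/\delta)/n}$, there is an $(\varepsilon,\delta)$-LNDP algorithm $\mathcal{A}$ on $n$-node graphs such that for every graph $G$ on $[n]$ consisting of a clique on a set $K\subseteq[n]$ with $k^*=|K|\ge n/10$ and no other edges (all nodes outside $K$ isolated), \[ \Pr\Big[|\mathcal{A}(G)-k^*|\le C\frac{\sqrt{\log(1/\delta)}}{\varepsilon}\Big]\ge\frac23. \]
   Context: Graphs are simple and undirected on node set $[n]$; $N_i^G$ is the neighborhood of node $i$. Two graphs on $[n]$ are node neighbors if they differ only in edges incident to a single node. Random variables $R_1,R_2$ are $(\varepsilon,\delta)$-indistinguishable if for every event $Y$, $\Pr[R_1\in Y]\le e^\varepsilon\Pr[R_2\in Y]+\delta$ and symmetrically. An algorithm $\mathcal{A}$ on $n$-node graphs is (noninteractive) $(\varepsilon,\delta)$-LNDP if there exist a distribution over public random strings $\rho$, local randomizers $\mathcal{R}_{1,\rho},\dots,\mathcal{R}_{n,\rho}$ (with independent internal randomness), and a postprocessing $\mathcal{P}$ with $\mathcal{A}(G)=\mathcal{P}(\mathcal{R}_{1,\rho}(N_1^G),\dots,\mathcal{R}_{n,\rho}(N_n^G))$, such that for every fixed $\rho$ and every node-neighboring $G,G'$ the randomizer output vectors on $G$ and $G'$ are $(\varepsilon,\delta)$-indistinguishable. *)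

theory Defs
  imports "HOL-Probability.Probability"
begin

definition graph_on :: "nat \<Rightarrow> (nat \<times> nat) set \<Rightarrow> bool" where
  "graph_on n E \<longleftrightarrow> E \<subseteq> {0..<n} \<times> {0..<n} \<and> (\<forall>i j. (i, j) \<in> E \<longrightarrow> (j, i) \<in> E \<and> i \<noteq> j)"

definition nbhd :: "(nat \<times> nat) set \<Rightarrow> nat \<Rightarrow> nat set" where
  "nbhd E i = {j. (i, j) \<in> E}"

definition node_neighbors :: "nat \<Rightarrow> (nat \<times> nat) set \<Rightarrow> (nat \<times> nat) set \<Rightarrow> bool" where
  "node_neighbors n E E' \<longleftrightarrow> graph_on n E \<and> graph_on n E' \<and>
     (\<exists>v<n. \<forall>i j. i \<noteq> v \<and> j \<noteq> v \<longrightarrow> ((i, j) \<in> E \<longleftrightarrow> (i, j) \<in> E'))"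

definition clique_graph :: "nat set \<Rightarrow> (nat \<times> nat) set" where
  "clique_graph K = {(i, j). i \<in> K \<and> j \<in> K \<and> i \<noteq> j}"

definition indist :: "real \<Rightarrow> real \<Rightarrow> 'a measure \<Rightarrow> 'a measure \<Rightarrow> bool" where
  "indist \<epsilon> \<delta> M1 M2 \<longleftrightarrow> sets M1 = sets M2 \<and>
     (\<forall>Y \<in> sets M1. measure M1 Y \<le> exp \<epsilon> * measure M2 Y + \<delta> \<and>
                     measure M2 Y \<le> exp \<epsilon> * measure M1 Y + \<delta>)"

text \<open>Algorithm data: public randomness \<rho> (a distribution on nat), local randomizers
  R i r S (node i, public string r, neighbourhood S) giving a real-valued random output,
  and a postprocessing P of the output vector.\<close>

definition outputs :: "nat \<Rightarrow> (nat \<Rightarrow> nat \<Rightarrow> nat set \<Rightarrow> real measure) \<Rightarrow> nat \<Rightarrow> (nat \<times> nat) set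
    \<Rightarrow> (nat \<Rightarrow> real) measure" where
  "outputs n R r G = PiM {0..<n} (\<lambda>i. R i r (nbhd G i))"

definition alg_out :: "nat \<Rightarrow> (nat \<Rightarrow> nat \<Rightarrow> nat set \<Rightarrow> real measure) \<Rightarrow> ((nat \<Rightarrow> real) \<Rightarrow> real)
    \<Rightarrow> nat \<Rightarrow> (nat \<times> nat) set \<Rightarrow> real measure" where
  "alg_out n R P r G = distr (outputs n R r G) borel P"

definition is_LNDP :: "nat \<Rightarrow> real \<Rightarrow> real \<Rightarrow> nat pmf \<Rightarrow> (nat \<Rightarrow> nat \<Rightarrow> nat set \<Rightarrow> real measure)
    \<Rightarrow> ((nat \<Rightarrow> real) \<Rightarrow> real) \<Rightarrow> bool" where
  "is_LNDP n \<epsilon> \<delta> \<rho> R P \<longleftrightarrow>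
     (\<forall>i r S. prob_space (R i r S) \<and> sets (R i r S) = sets borel) \<and>
     P \<in> borel_measurable (PiM {0..<n} (\<lambda>_. borel)) \<and>
     (\<forall>r \<in> set_pmf \<rho>. \<forall>G G'. node_neighbors n G G' \<longrightarrow>
        indist \<epsilon> \<delta> (outputs n R r G) (outputs n R r G'))"

definition alg_prob :: "nat \<Rightarrow> nat pmf \<Rightarrow> (nat \<Rightarrow> nat \<Rightarrow> nat set \<Rightarrow> real measure)
    \<Rightarrow> ((nat \<Rightarrow> real) \<Rightarrow> real) \<Rightarrow> (nat \<times> nat) set \<Rightarrow> real set \<Rightarrow> real" where
  "alg_prob n \<rho> R P G Y = (\<integral>r. measure (alg_out n R P r G) Y \<partial>(measure_pmf \<rho>))"

end

theory Submission
  imports Defs "HOL-Library.Nat_Bijection"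
begin

text \<open>Let \<open>B\<close> be about \<open>sqrt n\<close>. Public randomness supplies signs \<open>s i j\<close>. Node \<open>i\<close> of degree
  \<open>d = q B + t B\<close>, with \<open>0 \<le> t < 1\<close>, releases \<open>(1 - t) s i q + t s i (q + 1)\<close> plus Gaussian noise
  of standard deviation \<open>\<sigma> = 8 sqrt (ln (1/\<delta>)) / \<epsilon>\<close>. Changing one node moves its own value by at
  most 2 and every other value by at most \<open>2 / B\<close>, so the vector of values has \<open>\<ell>\<^sub>2\<close>-sensitivity at
  most \<open>sqrt 8\<close> and the Gaussian mechanism gives privacy.

  All nodes of a clique of size \<open>k\<close> have the same degree \<open>k - 1\<close>, and isolated nodes release pure
  noise. Correlating the outputs with the \<open>j\<close>-th sign vector therefore gives \<open>k (1 - t)\<close> for \<open>j = q\<close>,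
  \<open>k t\<close> for \<open>j = q + 1\<close> and 0 otherwise, up to an error of order \<open>(1 + \<sigma>) sqrt n\<close> at each fixed \<open>j\<close>.
  Because \<open>\<sigma>\<^sup>2 ln n\<close> is at most a small multiple of \<open>n\<close>, the errors at all \<open>j\<close> simultaneously stay
  below \<open>k / 4\<close>, so the largest correlation occurs at \<open>q\<close> or \<open>q + 1\<close>. The correlations next to it
  then determine \<open>t\<close> up to \<open>O((1 + \<sigma>) / sqrt n)\<close>, that is, \<open>k\<close> up to \<open>O(1 + \<sigma>)\<close>.\<close>

section \<open>Products of Gaussians\<close>

definition gauss_prod :: "(nat \<Rightarrow> real) \<Rightarrow> real \<Rightarrow> nat set \<Rightarrow> (nat \<Rightarrow> real) measure" where
  "gauss_prod \<mu> \<sigma> I = PiM I (\<lambda>i. density lborel (normal_density (\<mu> i) \<sigma>))"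

lemma sets_gauss_prod [measurable_cong]: "sets (gauss_prod \<mu> \<sigma> I) = sets (PiM I (\<lambda>_. borel))"
  unfolding gauss_prod_def by (intro sets_PiM_cong) auto

lemma space_gauss_prod: "space (gauss_prod \<mu> \<sigma> I) = PiE I (\<lambda>_. UNIV)"
  by (simp add: gauss_prod_def space_PiM)

lemma prob_space_gauss_prod: "\<sigma> > 0 \<Longrightarrow> prob_space (gauss_prod \<mu> \<sigma> I)"
  unfolding gauss_prod_def by (intro prob_space_PiM prob_space_normal_density) auto

lemma product_sigma_finite_normal:
  "\<sigma> > 0 \<Longrightarrow> product_sigma_finite (\<lambda>i. density lborel (normal_density (\<mu> i) \<sigma>))"
  by (intro product_sigma_finite.intro)
     (auto intro: prob_space_imp_sigma_finite prob_space_normal_density)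

text \<open>Completing the square: tilting the density by \<open>exp (l * (x - \<mu>))\<close> moves
  its mean by \<open>l * \<sigma>\<^sup>2\<close> and leaves a constant factor.\<close>

lemma nn_integral_normal_exp:
  assumes "\<sigma> > 0"
  shows "(\<integral>\<^sup>+x. ennreal (exp (l * (x - \<mu>))) \<partial>density lborel (normal_density \<mu> \<sigma>))
           = ennreal (exp (l\<^sup>2 * \<sigma>\<^sup>2 / 2))"
proof -
  have eq: "normal_density \<mu> \<sigma> x * exp (l * (x - \<mu>))
      = exp (l\<^sup>2 * \<sigma>\<^sup>2 / 2) * normal_density (\<mu> + l * \<sigma>\<^sup>2) \<sigma> x" for x
  proof -
    have "- (x - \<mu>)\<^sup>2 / (2 * \<sigma>\<^sup>2) + l * (x - \<mu>)
        = l\<^sup>2 * \<sigma>\<^sup>2 / 2 + - (x - (\<mu> + l * \<sigma>\<^sup>2))\<^sup>2 / (2 * \<sigma>\<^sup>2)"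
      using assms by (simp add: divide_simps) (simp add: algebra_simps power2_eq_square power4_eq_xxxx)
    then show ?thesis
      by (simp add: normal_density_def flip: exp_add)
  qed
  interpret prob_space "density lborel (normal_density (\<mu> + l * \<sigma>\<^sup>2) \<sigma>)"
    by (rule prob_space_normal_density[OF assms])
  have one: "(\<integral>\<^sup>+x. ennreal (normal_density (\<mu> + l * \<sigma>\<^sup>2) \<sigma> x) \<partial>lborel) = 1"
    using emeasure_space_1 by (simp add: emeasure_density)
  have "(\<integral>\<^sup>+x. ennreal (exp (l * (x - \<mu>))) \<partial>density lborel (normal_density \<mu> \<sigma>))
      = (\<integral>\<^sup>+x. ennreal (exp (l\<^sup>2 * \<sigma>\<^sup>2 / 2)) * ennreal (normal_density (\<mu> + l * \<sigma>\<^sup>2) \<sigma> x) \<partial>lborel)"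
    by (subst nn_integral_density) (simp_all add: eq flip: ennreal_mult)
  also have "\<dots> = ennreal (exp (l\<^sup>2 * \<sigma>\<^sup>2 / 2))"
    by (subst nn_integral_cmult) (simp_all add: one)
  finally show ?thesis .
qed

text \<open>Chernoff bound. The separate bound \<open>V\<close> keeps the exponent meaningful when
  all \<open>a i\<close> vanish, as they do for sign column 0.\<close>

lemma gauss_prod_tail:
  assumes "\<sigma> > 0" "finite I" "T \<ge> 0" "V > 0" "(\<Sum>i\<in>I. (a i)\<^sup>2) \<le> V"
  shows "measure (gauss_prod \<mu> \<sigma> I) {y \<in> space (gauss_prod \<mu> \<sigma> I). T \<le> (\<Sum>i\<in>I. a i * (y i - \<mu> i))}
           \<le> exp (- T\<^sup>2 / (2 * \<sigma>\<^sup>2 * V))" (is "measure ?M ?A \<le> _")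
proof -
  interpret prob_space ?M
    by (rule prob_space_gauss_prod[OF assms(1)])
  interpret P: product_sigma_finite "\<lambda>i. density lborel (normal_density (\<mu> i) \<sigma>)"
    by (rule product_sigma_finite_normal[OF assms(1)])
  \<comment> \<open>The minimizer of
    \<open>- l * T + l\<^sup>2 * \<sigma>\<^sup>2 / 2 * V\<close>.\<close>
  define l where "l = T / (\<sigma>\<^sup>2 * V)"
  have l: "l \<ge> 0" using assms by (simp add: l_def)
  have A[measurable]: "?A \<in> sets ?M"
    by measurable
  have "emeasure ?M ?A = (\<integral>\<^sup>+y. indicator ?A y \<partial>?M)"
    by simp
  also have "\<dots> \<le> (\<integral>\<^sup>+y. ennreal (exp (- l * T)) * (\<Prod>i\<in>I. ennreal (exp (l * a i * (y i - \<mu> i)))) \<partial>?M)"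
  proof (intro nn_integral_mono)
    fix y
    have "(\<Prod>i\<in>I. ennreal (exp (l * a i * (y i - \<mu> i)))) = ennreal (exp (l * (\<Sum>i\<in>I. a i * (y i - \<mu> i))))"
      using assms(2) by (simp add: prod_ennreal sum_distrib_left exp_sum mult.assoc)
    then have "ennreal (exp (- l * T)) * (\<Prod>i\<in>I. ennreal (exp (l * a i * (y i - \<mu> i))))
        = ennreal (exp (l * ((\<Sum>i\<in>I. a i * (y i - \<mu> i)) - T)))"
      by (simp add: algebra_simps exp_diff exp_minus field_simps flip: ennreal_mult)
    then show "indicator ?A y \<le> ennreal (exp (- l * T)) * (\<Prod>i\<in>I. ennreal (exp (l * a i * (y i - \<mu> i))))"
      using l by (auto simp: indicator_def)
  qed
  also have "\<dots> = ennreal (exp (- l * T)) * (\<integral>\<^sup>+y. (\<Prod>i\<in>I. ennreal (exp (l * a i * (y i - \<mu> i)))) \<partial>?M)"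
    by (subst nn_integral_cmult) auto
  also have "(\<integral>\<^sup>+y. (\<Prod>i\<in>I. ennreal (exp (l * a i * (y i - \<mu> i)))) \<partial>?M)
      = (\<Prod>i\<in>I. ennreal (exp ((l * a i)\<^sup>2 * \<sigma>\<^sup>2 / 2)))"
    unfolding gauss_prod_def using assms
    by (subst P.product_nn_integral_prod) (auto simp: nn_integral_normal_exp)
  also have "\<dots> = ennreal (exp (l\<^sup>2 * \<sigma>\<^sup>2 / 2 * (\<Sum>i\<in>I. (a i)\<^sup>2)))"
    using assms(2)
    by (simp add: prod_ennreal sum_distrib_left exp_sum[symmetric] power_mult_distrib algebra_simps)
  also have "ennreal (exp (- l * T)) * \<dots> \<le> ennreal (exp (- T\<^sup>2 / (2 * \<sigma>\<^sup>2 * V)))"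
  proof -
    have "l\<^sup>2 * \<sigma>\<^sup>2 / 2 * (\<Sum>i\<in>I. (a i)\<^sup>2) \<le> l\<^sup>2 * \<sigma>\<^sup>2 / 2 * V"
      using assms by (intro mult_left_mono) auto
    moreover have "- l * T + l\<^sup>2 * \<sigma>\<^sup>2 / 2 * V = - T\<^sup>2 / (2 * \<sigma>\<^sup>2 * V)"
      using assms by (simp add: l_def field_simps power2_eq_square)
    ultimately show ?thesis
      by (simp flip: ennreal_mult exp_add)
  qed
  finally show ?thesis
    by (simp add: emeasure_eq_measure)
qed

lemma gauss_prod_tail_abs:
  assumes "\<sigma> > 0" "finite I" "T \<ge> 0" "V > 0" "(\<Sum>i\<in>I. (a i)\<^sup>2) \<le> V"
  shows "measure (gauss_prod \<mu> \<sigma> I) {y \<in> space (gauss_prod \<mu> \<sigma> I). T \<le> \<bar>\<Sum>i\<in>I. a i * (y i - \<mu> i)\<bar>}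
           \<le> 2 * exp (- T\<^sup>2 / (2 * \<sigma>\<^sup>2 * V))" (is "measure ?M ?A \<le> _")
proof -
  interpret prob_space ?M
    by (rule prob_space_gauss_prod[OF assms(1)])
  let ?B = "\<lambda>a. {y \<in> space ?M. T \<le> (\<Sum>i\<in>I. a i * (y i - \<mu> i))}"
  have "measure ?M ?A \<le> measure ?M (?B a \<union> ?B (\<lambda>i. - a i))"
    by (intro finite_measure_mono) (auto simp: abs_if sum_negf split: if_splits)
  also have "\<dots> \<le> measure ?M (?B a) + measure ?M (?B (\<lambda>i. - a i))"
    by (intro measure_Un_le) measurable
  also have "\<dots> \<le> exp (- T\<^sup>2 / (2 * \<sigma>\<^sup>2 * V)) + exp (- T\<^sup>2 / (2 * \<sigma>\<^sup>2 * V))"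
    using assms by (intro add_mono gauss_prod_tail) auto
  finally show ?thesis by simp
qed

text \<open>This is the likelihood ratio: the normalizing constants cancel because
  \<open>\<sigma>\<close> is shared, and a product measure is determined by its values on
  boxes.\<close>

lemma gauss_prod_density:
  assumes "\<sigma> > 0" "finite I"
  shows "gauss_prod \<mu> \<sigma> I = density (gauss_prod \<mu>' \<sigma> I)
    (\<lambda>y. \<Prod>i\<in>I. ennreal (exp (((y i - \<mu>' i)\<^sup>2 - (y i - \<mu> i)\<^sup>2) / (2 * \<sigma>\<^sup>2))))"
proof -
  let ?h = "\<lambda>i x. ennreal (exp (((x - \<mu>' i)\<^sup>2 - (x - \<mu> i)\<^sup>2) / (2 * \<sigma>\<^sup>2)))"
  interpret P: product_sigma_finite "\<lambda>i. density lborel (normal_density (\<mu> i) \<sigma>)"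
    by (rule product_sigma_finite_normal[OF assms(1)])
  interpret P': product_sigma_finite "\<lambda>i. density lborel (normal_density (\<mu>' i) \<sigma>)"
    by (rule product_sigma_finite_normal[OF assms(1)])
  have eq: "normal_density (\<mu>' i) \<sigma> x * exp (((x - \<mu>' i)\<^sup>2 - (x - \<mu> i)\<^sup>2) / (2 * \<sigma>\<^sup>2))
      = normal_density (\<mu> i) \<sigma> x" for i x
  proof -
    have "- (x - \<mu>' i)\<^sup>2 / (2 * \<sigma>\<^sup>2) + ((x - \<mu>' i)\<^sup>2 - (x - \<mu> i)\<^sup>2) / (2 * \<sigma>\<^sup>2) = - (x - \<mu> i)\<^sup>2 / (2 * \<sigma>\<^sup>2)"
      by (simp add: diff_divide_distrib)
    then show ?thesis
      by (simp add: normal_density_def flip: exp_add)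
  qed
  have "density (gauss_prod \<mu>' \<sigma> I) (\<lambda>y. \<Prod>i\<in>I. ?h i (y i)) = gauss_prod \<mu> \<sigma> I"
    unfolding gauss_prod_def[of \<mu>]
  proof (rule P.PiM_eqI)
    show "sets (density (gauss_prod \<mu>' \<sigma> I) (\<lambda>y. \<Prod>i\<in>I. ?h i (y i)))
        = sets (Pi\<^sub>M I (\<lambda>i. density lborel (normal_density (\<mu> i) \<sigma>)))"
      by (simp add: sets_gauss_prod cong: sets_PiM_cong)
  next
    fix A :: "nat \<Rightarrow> real set" assume "\<And>i. i \<in> I \<Longrightarrow> A i \<in> sets (density lborel (\<lambda>x. ennreal (normal_density (\<mu> i) \<sigma> x)))"
    then have A: "\<And>i. i \<in> I \<Longrightarrow> A i \<in> sets borel" by simp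
    then have PA: "Pi\<^sub>E I A \<in> sets (gauss_prod \<mu>' \<sigma> I)"
      unfolding sets_gauss_prod using assms by (intro sets_PiM_I_finite) auto
    have "emeasure (density (gauss_prod \<mu>' \<sigma> I) (\<lambda>y. \<Prod>i\<in>I. ?h i (y i))) (Pi\<^sub>E I A)
        = (\<integral>\<^sup>+y. (\<Prod>i\<in>I. ?h i (y i)) * indicator (Pi\<^sub>E I A) y \<partial>gauss_prod \<mu>' \<sigma> I)"
      by (intro emeasure_density PA) measurable
    also have "\<dots> = (\<integral>\<^sup>+y. (\<Prod>i\<in>I. ?h i (y i) * indicator (A i) (y i)) \<partial>gauss_prod \<mu>' \<sigma> I)"
    proof (intro nn_integral_cong)
      fix y assume "y \<in> space (gauss_prod \<mu>' \<sigma> I)"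
      then have "indicator (Pi\<^sub>E I A) y = (\<Prod>i\<in>I. indicator (A i) (y i) :: ennreal)"
        using assms(2) by (auto simp: space_gauss_prod indicator_def PiE_def Pi_def)
      then show "(\<Prod>i\<in>I. ?h i (y i)) * indicator (Pi\<^sub>E I A) y = (\<Prod>i\<in>I. ?h i (y i) * indicator (A i) (y i))"
        by (simp add: prod.distrib)
    qed
    also have "\<dots> = (\<Prod>i\<in>I. \<integral>\<^sup>+x. ?h i x * indicator (A i) x \<partial>density lborel (normal_density (\<mu>' i) \<sigma>))"
      unfolding gauss_prod_def using A assms
      by (intro P'.product_nn_integral_prod) auto
    also have "\<dots> = (\<Prod>i\<in>I. emeasure (density lborel (normal_density (\<mu> i) \<sigma>)) (A i))"
    proof (intro prod.cong refl)
      fix i assume "i \<in> I"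
      then have [measurable]: "A i \<in> sets borel" by (rule A)
      have "(\<integral>\<^sup>+x. ?h i x * indicator (A i) x \<partial>density lborel (normal_density (\<mu>' i) \<sigma>))
         = (\<integral>\<^sup>+x. ennreal (normal_density (\<mu> i) \<sigma> x) * indicator (A i) x \<partial>lborel)"
        by (subst nn_integral_density)
           (simp_all add: eq mult.assoc[symmetric] flip: ennreal_mult)
      also have "\<dots> = emeasure (density lborel (normal_density (\<mu> i) \<sigma>)) (A i)"
        by (subst emeasure_density) auto
      finally show "(\<integral>\<^sup>+x. ?h i x * indicator (A i) x \<partial>density lborel (normal_density (\<mu>' i) \<sigma>))
         = emeasure (density lborel (normal_density (\<mu> i) \<sigma>)) (A i)" .
    qed
    finally show "emeasure (density (gauss_prod \<mu>' \<sigma> I) (\<lambda>y. \<Prod>i\<in>I. ?h i (y i))) (Pi\<^sub>E I A)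
        = (\<Prod>i\<in>I. emeasure (density lborel (normal_density (\<mu> i) \<sigma>)) (A i))" .
  qed fact
  then show ?thesis by simp
qed

section \<open>Privacy of the Gaussian mechanism\<close>

lemma ln_inverse_ge_half:
  fixes \<delta> :: real
  assumes "0 < \<delta>" "\<delta> \<le> 1/2"
  shows "ln (1/\<delta>) \<ge> 1/2"
proof -
  have "ln 2 \<le> ln (1/\<delta>)" using assms by (subst ln_le_cancel_iff) (auto simp: field_simps)
  then show ?thesis using ln2_ge_two_thirds by linarith
qed

text \<open>The privacy loss splits into a centred linear part and a constant part. The choice of
  \<open>\<sigma>\<close> keeps the linear part below \<open>\<epsilon> / 2\<close> except with
  probability \<open>\<delta>\<close>, and the constant part is at most
  \<open>\<epsilon> / 2\<close> because \<open>\<epsilon> \<le> 1\<close> and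
  \<open>ln (1/\<delta>) \<ge> 1/2\<close>.\<close>

lemma gaussian_mechanism:
  assumes \<epsilon>: "0 < \<epsilon>" "\<epsilon> \<le> 1" and \<delta>: "0 < \<delta>" "\<delta> \<le> 1/2"
    and I: "finite I" and D: "D > 0" "(\<Sum>i\<in>I. (\<mu> i - \<mu>' i)\<^sup>2) \<le> D"
    and \<sigma>: "\<sigma> > 0" "\<sigma>\<^sup>2 = 8 * D * ln (1/\<delta>) / \<epsilon>\<^sup>2"
  shows "indist \<epsilon> \<delta> (gauss_prod \<mu> \<sigma> I) (gauss_prod \<mu>' \<sigma> I)"
proof -
  \<comment> \<open>Stated for arbitrary means, so that swapping them yields the other half of
    \<open>indist\<close>.\<close>
  have *: "measure (gauss_prod \<mu> \<sigma> I) Y \<le> exp \<epsilon> * measure (gauss_prod \<mu>' \<sigma> I) Y + \<delta>"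
    if Y: "Y \<in> sets (PiM I (\<lambda>_. borel))" and D2: "(\<Sum>i\<in>I. (\<mu> i - \<mu>' i)\<^sup>2) \<le> D" for \<mu> \<mu>' Y
  proof -
    let ?M = "gauss_prod \<mu> \<sigma> I" and ?M' = "gauss_prod \<mu>' \<sigma> I"
    interpret M: prob_space ?M by (rule prob_space_gauss_prod[OF \<sigma>(1)])
    interpret M': prob_space ?M' by (rule prob_space_gauss_prod[OF \<sigma>(1)])
    \<comment> \<open>\<open>L\<close> is the privacy loss; it exceeds \<open>\<epsilon>\<close> only on the tail event \<open>?B\<close>\<close>
    define L where "L y = (\<Sum>i\<in>I. ((y i - \<mu>' i)\<^sup>2 - (y i - \<mu> i)\<^sup>2) / (2 * \<sigma>\<^sup>2))" for y
    have [measurable]: "L \<in> borel_measurable (PiM I (\<lambda>_. borel))"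
      unfolding L_def by measurable
    have Y'[measurable]: "Y \<in> sets ?M" "Y \<in> sets ?M'"
      using Y by (simp_all add: sets_gauss_prod)
    define l where "l = ln (1/\<delta>)"
    have l: "l \<ge> 1/2" unfolding l_def by (rule ln_inverse_ge_half[OF \<delta>])
    \<comment> \<open>At this threshold the linear part of \<open>L\<close> equals
      \<open>\<epsilon> / 2\<close>, and the tail bound evaluates to exactly
      \<open>\<delta>\<close>.\<close>
    define T where "T = \<sigma>\<^sup>2 * (\<epsilon> / 2)"
    let ?B = "{y \<in> space ?M. T \<le> (\<Sum>i\<in>I. (\<mu> i - \<mu>' i) * (y i - \<mu> i))}"
    have B[measurable]: "?B \<in> sets ?M" by measurable
    have "measure ?M ?B \<le> exp (- T\<^sup>2 / (2 * \<sigma>\<^sup>2 * D))"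
      using \<sigma>(1) I D D2 \<epsilon> by (intro gauss_prod_tail) (auto simp: T_def)
    also have "- T\<^sup>2 / (2 * \<sigma>\<^sup>2 * D) = - (\<sigma>\<^sup>2 * \<epsilon>\<^sup>2 / (8 * D))"
      using \<sigma>(1) D by (simp add: T_def field_simps power2_eq_square)
    also have "\<sigma>\<^sup>2 * \<epsilon>\<^sup>2 / (8 * D) = l"
      using \<epsilon> D by (simp add: \<sigma>(2) l_def)
    also have "exp (- l) = \<delta>"
      using \<delta> by (simp add: l_def exp_minus ln_div)
    finally have PB: "measure ?M ?B \<le> \<delta>" .
    have small: "L y \<le> \<epsilon>" if "y \<in> space ?M" "y \<notin> ?B" for y
    proof -
      have "L y = (\<Sum>i\<in>I. (2 * ((\<mu> i - \<mu>' i) * (y i - \<mu> i)) + (\<mu> i - \<mu>' i)\<^sup>2) / (2 * \<sigma>\<^sup>2))"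
        unfolding L_def by (intro sum.cong refl arg_cong2[where f="(/)"]) (auto simp: power2_eq_square algebra_simps)
      also have "\<dots> = (2 * (\<Sum>i\<in>I. (\<mu> i - \<mu>' i) * (y i - \<mu> i)) + (\<Sum>i\<in>I. (\<mu> i - \<mu>' i)\<^sup>2)) / (2 * \<sigma>\<^sup>2)"
        by (simp add: sum_divide_distrib[symmetric] sum.distrib sum_distrib_left)
      also have "\<dots> \<le> (2 * T + D) / (2 * \<sigma>\<^sup>2)"
        using that D2 \<sigma>(1) by (intro divide_right_mono add_mono) auto
      also have "\<dots> = \<epsilon> / 2 + D / (2 * \<sigma>\<^sup>2)"
        using \<sigma>(1) by (simp add: T_def field_simps)
      also have "D / (2 * \<sigma>\<^sup>2) = \<epsilon>\<^sup>2 / (16 * l)"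
        using D l by (simp add: \<sigma>(2) l_def field_simps)
      also have "\<dots> \<le> \<epsilon> / 2"
      proof -
        have "\<epsilon>\<^sup>2 \<le> \<epsilon>" using \<epsilon> by (simp add: power2_eq_square mult_left_le)
        also have "\<epsilon> \<le> \<epsilon> * (8 * l)" using \<epsilon> l by simp
        finally show ?thesis using l by (simp add: field_simps)
      qed
      finally show ?thesis by simp
    qed
    have h: "(\<Prod>i\<in>I. ennreal (exp (((y i - \<mu>' i)\<^sup>2 - (y i - \<mu> i)\<^sup>2) / (2 * \<sigma>\<^sup>2)))) = ennreal (exp (L y))" for y
      using I by (simp add: L_def exp_sum prod_ennreal)
    have dens: "?M = density ?M' (\<lambda>y. ennreal (exp (L y)))"
      using gauss_prod_density[OF \<sigma>(1) I, of \<mu> \<mu>'] unfolding h .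
    have B'[measurable]: "?B \<in> sets ?M'" using B by (simp add: sets_gauss_prod)
    \<comment> \<open>The event is split: off \<open>?B\<close> the density is at most
      \<open>exp \<epsilon>\<close>, and \<open>?B\<close> itself costs at most
      \<open>\<delta>\<close>.\<close>
    have "emeasure ?M (Y - ?B) = (\<integral>\<^sup>+y. ennreal (exp (L y)) * indicator (Y - ?B) y \<partial>?M')"
      by (subst dens, subst emeasure_density) auto
    also have "\<dots> \<le> (\<integral>\<^sup>+y. ennreal (exp \<epsilon>) * indicator Y y \<partial>?M')"
      using small by (intro nn_integral_mono) (auto simp: indicator_def space_gauss_prod)
    also have "\<dots> = ennreal (exp \<epsilon> * measure ?M' Y)"
      by (subst nn_integral_cmult_indicator) (auto simp: M'.emeasure_eq_measure ennreal_mult)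
    finally have "measure ?M (Y - ?B) \<le> exp \<epsilon> * measure ?M' Y"
      by (simp add: M.emeasure_eq_measure)
    moreover have "measure ?M Y \<le> measure ?M ((Y - ?B) \<union> ?B)"
      by (intro M.finite_measure_mono) auto
    moreover have "\<dots> \<le> measure ?M (Y - ?B) + measure ?M ?B"
      by (intro measure_Un_le) auto
    ultimately show ?thesis using PB by linarith
  qed
  have "(\<Sum>i\<in>I. (\<mu>' i - \<mu> i)\<^sup>2) \<le> D"
    using D(2) by (simp add: power2_commute)
  with * D(2) show ?thesis
    unfolding indist_def by (simp add: sets_gauss_prod)
qed

text \<open>Closure under postprocessing, since preimages of events are events. It carries privacy
  from plain Gaussian vectors to the encoded outputs.\<close>

lemma indist_distr:
  assumes "indist \<epsilon> \<delta> M M'" "f \<in> measurable M N"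
  shows "indist \<epsilon> \<delta> (distr M N f) (distr M' N f)"
proof -
  have s: "sets M = sets M'" and sp: "space M = space M'"
    using assms(1) by (auto simp: indist_def dest: sets_eq_imp_space_eq)
  have f': "f \<in> measurable M' N"
    using assms(2) s by (simp cong: measurable_cong_sets)
  show ?thesis
    using assms(1) measurable_sets[OF assms(2)]
    unfolding indist_def by (simp add: measure_distr[OF assms(2)] measure_distr[OF f'] sp)
qed

section \<open>Sign vectors and decoding\<close>

text \<open>One set of naturals holds the whole table of signs, with each index pair packed into a
  number, because the public string has to be a single natural number.\<close>

definition sign_bit :: "nat set \<Rightarrow> nat \<Rightarrow> nat \<Rightarrow> real" where
  "sign_bit S i j = (if j = 0 then 0 else if prod_encode (i, j) \<in> S then 1 else - 1)"

text \<open>Piecewise linear interpolation, with block length \<open>B\<close>, of the public signs. The value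
  0 at index 0 makes degree-0 nodes contribute nothing.\<close>

definition profile :: "nat set \<Rightarrow> nat \<Rightarrow> nat \<Rightarrow> nat \<Rightarrow> real" where
  "profile S B i d = (1 - real (d mod B) / real B) * sign_bit S i (d div B)
                       + real (d mod B) / real B * sign_bit S i (d div B + 1)"

definition corr :: "nat set \<Rightarrow> nat set \<Rightarrow> nat \<Rightarrow> nat \<Rightarrow> real" where
  "corr S K j j' = (\<Sum>i\<in>K. sign_bit S i j * sign_bit S i j')"

definition stat :: "nat set \<Rightarrow> nat \<Rightarrow> (nat \<Rightarrow> real) \<Rightarrow> nat \<Rightarrow> real" where
  "stat S n y j = (\<Sum>i<n. sign_bit S i j * y i)"

text \<open>Ties go to the smallest index, a form that is easily seen to be measurable. Index 0
  carries no signs and is left out.\<close>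

definition argmax :: "nat \<Rightarrow> (nat \<Rightarrow> real) \<Rightarrow> nat" where
  "argmax m g = (LEAST j. j \<in> {1..m} \<and> (\<forall>j'\<in>{1..m}. g j' \<le> g j))"

text \<open>If \<open>k - 1 = q B + t B\<close>, then \<open>g\<close> is about \<open>k (1 - t)\<close> at \<open>q\<close>, about \<open>k t\<close> at \<open>q + 1\<close>, and
  small elsewhere, and \<open>k\<close> is about \<open>j B\<close>. So both for \<open>j = q\<close> and for \<open>j = q + 1\<close>, the signed
  distance from \<open>j B\<close> to \<open>k - 1\<close> is about \<open>B (g (j + 1) - g (j - 1)) / k\<close>.\<close>

definition interpolate :: "nat \<Rightarrow> (nat \<Rightarrow> real) \<Rightarrow> nat \<Rightarrow> real" where
  "interpolate B g j = 1 + real j * real B + (g (j + 1) - g (j - 1)) / real j"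

definition estimate :: "nat set \<Rightarrow> nat \<Rightarrow> nat \<Rightarrow> (nat \<Rightarrow> real) \<Rightarrow> real" where
  "estimate S n B y = interpolate B (stat S n y) (argmax (2 * B) (stat S n y))"

section \<open>Size and slope of the profile\<close>

lemma sign_bit_abs_le: "\<bar>sign_bit S i j\<bar> \<le> 1"
  by (simp add: sign_bit_def)

lemma sign_bit_square: "j > 0 \<Longrightarrow> (sign_bit S i j)\<^sup>2 = 1"
  by (simp add: sign_bit_def)

lemma sum_sign_bit_square_le: "(\<Sum>i<n. (sign_bit S i j)\<^sup>2) \<le> real n"
  using sum_bounded_above[of "{..<n}" "\<lambda>i. (sign_bit S i j)\<^sup>2" 1]
  by (simp add: abs_square_le_1 sign_bit_abs_le)

lemma abs_convex_le:
  fixes x y t :: real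
  assumes "0 \<le> t" "t \<le> 1" "\<bar>x\<bar> \<le> a" "\<bar>y\<bar> \<le> a"
  shows "\<bar>(1 - t) * x + t * y\<bar> \<le> a"
proof -
  have "\<bar>(1 - t) * x + t * y\<bar> \<le> \<bar>(1 - t) * x\<bar> + \<bar>t * y\<bar>" by (rule abs_triangle_ineq)
  also have "\<dots> = (1 - t) * \<bar>x\<bar> + t * \<bar>y\<bar>" using assms by (simp add: abs_mult)
  also have "\<dots> \<le> (1 - t) * a + t * a" using assms by (intro add_mono mult_left_mono) auto
  finally show ?thesis by (simp add: algebra_simps)
qed

lemma profile_0 [simp]: "profile S B i 0 = 0"
  by (simp add: profile_def sign_bit_def)

lemma profile_abs_le:
  assumes "B > 0"
  shows "\<bar>profile S B i d\<bar> \<le> 1"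
proof -
  have "real (d mod B) / real B \<le> 1" using assms by (simp add: less_imp_le)
  then show ?thesis
    unfolding profile_def by (intro abs_convex_le sign_bit_abs_le) auto
qed

text \<open>The profile is linear on each block, between two values in \<open>[-1, 1]\<close>, and
  the end of a block meets the value that opens the next one. This bounds the change at every node
  other than the modified one.\<close>

lemma profile_Suc_diff:
  assumes "B > 0"
  shows "\<bar>profile S B i (Suc d) - profile S B i d\<bar> \<le> 2 / real B"
proof -
  define a b where "a = sign_bit S i (d div B)" and "b = sign_bit S i (d div B + 1)"
  have "profile S B i (Suc d) - profile S B i d = (b - a) / real B"
  proof (cases "Suc (d mod B) = B")
    case True
    then have "Suc d mod B = 0" "Suc d div B = d div B + 1"
      by (simp_all add: mod_Suc div_Suc)
    moreover have "real (d mod B) / real B = 1 - 1 / real B"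
      using True assms by (simp add: field_simps)
    ultimately show ?thesis
      using assms by (simp add: profile_def a_def b_def diff_divide_distrib left_diff_distrib)
  next
    case False
    then have "Suc d mod B = Suc (d mod B)" "Suc d div B = d div B"
      using assms by (auto simp: mod_Suc div_Suc)
    then show ?thesis
      using assms by (simp add: profile_def a_def b_def field_simps)
  qed
  moreover have "\<bar>b - a\<bar> \<le> 2"
    using sign_bit_abs_le[of S i "d div B"] sign_bit_abs_le[of S i "d div B + 1"]
    unfolding a_def b_def by linarith
  ultimately show ?thesis
    using assms by (simp add: abs_divide divide_right_mono)
qed

section \<open>Second moments of the sign correlations\<close>

text \<open>After expanding the square only the diagonal survives: for \<open>i \<noteq> i'\<close>
  the summand contains the sign at \<open>(i, j)\<close> exactly once, and averaging over that sign
  gives 0.\<close>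

lemma sum_Pow_corr_square:
  assumes "finite A" "finite K" "j > 0" "j' > 0" "j \<noteq> j'" "\<And>i. i \<in> K \<Longrightarrow> prod_encode (i, j) \<in> A"
  shows "(\<Sum>S\<in>Pow A. (corr S K j j')\<^sup>2) = real (card K) * real (card (Pow A))"
proof -
  let ?t = "\<lambda>S i. sign_bit S i j * sign_bit S i j'"
  have cross: "(\<Sum>S\<in>Pow A. ?t S i * ?t S i') = (if i = i' then real (card (Pow A)) else 0)"
    if "i \<in> K" "i' \<in> K" for i i'
  proof (cases "i = i'")
    case True
    have "?t S i * ?t S i = 1" for S
      using assms(3,4) by (simp add: sign_bit_def)
    then show ?thesis using True by simp
  next
    case False
    let ?x = "prod_encode (i, j)"
    \<comment> \<open>toggling the bit of \<open>(i, j)\<close> is an involution that negates the summand\<close>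
    define flip where "flip S = (if ?x \<in> S then S - {?x} else insert ?x S)" for S
    have "(\<Sum>S\<in>Pow A. ?t S i * ?t S i') = (\<Sum>S\<in>Pow A. - (?t S i * ?t S i'))"
    proof (rule sum.reindex_bij_witness[of _ flip flip])
      fix S
      have "sign_bit (flip S) i j = - sign_bit S i j"
        "sign_bit (flip S) i j' = sign_bit S i j'"
        "sign_bit (flip S) i' j = sign_bit S i' j"
        "sign_bit (flip S) i' j' = sign_bit S i' j'"
        using False assms(3-5) by (auto simp: sign_bit_def flip_def prod_encode_eq)
      then show "- (?t (flip S) i * ?t (flip S) i') = ?t S i * ?t S i'" by simp
    qed (use assms(6)[OF that(1)] in \<open>auto simp: flip_def\<close>)
    then show ?thesis using False by (simp add: sum_negf)
  qed
  have "(\<Sum>S\<in>Pow A. (corr S K j j')\<^sup>2) = (\<Sum>S\<in>Pow A. \<Sum>i\<in>K. \<Sum>i'\<in>K. ?t S i * ?t S i')"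
    by (simp add: corr_def power2_eq_square sum_product)
  also have "\<dots> = (\<Sum>i\<in>K. \<Sum>i'\<in>K. \<Sum>S\<in>Pow A. ?t S i * ?t S i')"
    by (subst sum.swap) (intro sum.cong refl sum.swap)
  also have "\<dots> = (\<Sum>i\<in>K. \<Sum>i'\<in>K. if i = i' then real (card (Pow A)) else 0)"
    by (intro sum.cong refl cross)
  also have "\<dots> = real (card K) * real (card (Pow A))"
    using assms(2) by simp
  finally show ?thesis .
qed

text \<open>Chebyshev's inequality, written as a count over the subsets of \<open>A\<close>.\<close>

lemma prob_corr_ge:
  assumes "finite A" "finite K" "j > 0" "j' > 0" "j \<noteq> j'" "\<And>i. i \<in> K \<Longrightarrow> prod_encode (i, j) \<in> A" "T > 0"
  shows "measure_pmf.prob (pmf_of_set (Pow A)) {S. T \<le> \<bar>corr S K j j'\<bar>} \<le> real (card K) / T\<^sup>2"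
proof -
  let ?B = "{S. T \<le> \<bar>corr S K j j'\<bar>}"
  have "real (card (Pow A \<inter> ?B)) * T\<^sup>2 = (\<Sum>S\<in>Pow A \<inter> ?B. T\<^sup>2)"
    by simp
  also have "\<dots> \<le> (\<Sum>S\<in>Pow A \<inter> ?B. (corr S K j j')\<^sup>2)"
    using assms(7) by (intro sum_mono) (simp add: abs_le_square_iff[symmetric])
  also have "\<dots> \<le> (\<Sum>S\<in>Pow A. (corr S K j j')\<^sup>2)"
    using assms(1) by (intro sum_mono2) auto
  also have "\<dots> = real (card K) * real (card (Pow A))"
    using assms by (intro sum_Pow_corr_square) auto
  finally have "real (card (Pow A \<inter> ?B)) * T\<^sup>2 \<le> real (card K) * real (card (Pow A))" .
  moreover have "card (Pow A) > 0"
    using assms(1) by (simp add: card_Pow)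
  moreover have "Pow A \<noteq> {}" "finite (Pow A)" using assms(1) by auto
  ultimately show ?thesis
    using assms(7) by (simp add: measure_pmf_of_set divide_simps mult.commute del: card_Pow)
qed

section \<open>Deterministic analysis of the decoder\<close>

lemma argmax_props:
  assumes "m > 0"
  shows "argmax m g \<in> {1..m}" "\<And>j. j \<in> {1..m} \<Longrightarrow> g j \<le> g (argmax m g)"
proof -
  let ?P = "\<lambda>j. j \<in> {1..m} \<and> (\<forall>j'\<in>{1..m}. g j' \<le> g j)"
  obtain j where j: "j \<in> {1..m}" "g j = Max (g ` {1..m})"
    using assms Max_in[of "g ` {1..m}"] by fastforce
  then have "?P j" by auto
  then have "?P (argmax m g)"
    unfolding argmax_def by (rule LeastI)
  then show "argmax m g \<in> {1..m}" "\<And>j. j \<in> {1..m} \<Longrightarrow> g j \<le> g (argmax m g)" by auto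
qed

text \<open>The two peaks add up to \<open>k\<close>, so one of them is at least
  \<open>k / 2\<close>, and with errors below \<open>k / 4\<close> no third index can win. Only the
  four columns around the peaks enter the accuracy, hence the separate bound \<open>E\<close>
  there.\<close>

lemma interpolate_argmax_error:
  fixes g :: "nat \<Rightarrow> real"
  assumes k: "k = q * B + r + 1" "r < B" and q: "q \<ge> 2" "q + 2 \<le> m"
    and peak_def: "peak = (\<lambda>j. if j = q then real k * (1 - real r / real B)
                     else if j = q + 1 then real k * (real r / real B) else 0)"
    and far: "\<And>j. j \<in> {1..m} \<Longrightarrow> \<bar>g j - peak j\<bar> < real k / 4"
    and near: "\<And>j. j \<in> {q - 1..q + 2} \<Longrightarrow> \<bar>g j - peak j\<bar> \<le> E"
  shows "\<bar>interpolate B g (argmax m g) - real k\<bar> \<le> (real B + 2 * E) / real q"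
proof -
  define t where "t = real r / real B"
  have B: "real B > 0" using k by simp
  have t: "0 \<le> t" "t \<le> 1" using k by (auto simp: t_def)
  have kt: "real k = real q * real B + t * real B + 1" using k B by (simp add: t_def)
  have tB: "t * real B = real r" using B by (simp add: t_def)
  have rB: "real r + 1 \<le> real B" using k(2) by linarith
  let ?j = "argmax m g"
  have m: "m > 0" using q by simp
  have j: "?j \<in> {1..m}" by (rule argmax_props[OF m])
  have E: "E \<ge> 0" using near[of q] by force
  consider "?j = q" | "?j = q + 1"
  proof -
    have "?j = q \<or> ?j = q + 1"
    proof (rule ccontr)
      assume "\<not> ?thesis"
      then have "peak ?j = 0" by (simp add: peak_def)
      then have 1: "g ?j < real k / 4" using far[OF j] by simp
      have "g q \<le> g ?j" "g (q + 1) \<le> g ?j" using q by (auto intro!: argmax_props)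
      moreover have "\<bar>g q - real k * (1 - t)\<bar> < real k / 4" "\<bar>g (q + 1) - real k * t\<bar> < real k / 4"
        using far[of q] far[of "q + 1"] q by (simp_all add: peak_def t_def)
      moreover have "real k * (1 - t) + real k * t = real k" by (simp add: algebra_simps)
      ultimately show False using 1 by linarith
    qed
    then show ?thesis using that by blast
  qed
  then show ?thesis
  proof cases
    case 1
    have q0: "real q > 0" using q by simp
    have n1: "\<bar>g (q + 1) - real k * t\<bar> \<le> E" using near[of "q + 1"] by (simp add: peak_def t_def)
    have n2: "\<bar>g (q - 1)\<bar> \<le> E" 
    proof -
      have "q - 1 \<noteq> q" "q - 1 \<noteq> q + 1" "q - 1 \<in> {q - 1..q + 2}" using q by auto
      then show ?thesis using near[of "q - 1"] by (simp only: peak_def if_False diff_zero)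
    qed
    \<comment> \<open>An exact answer would need the difference of neighbours to be
      \<open>q * B * t\<close>; its ideal value is \<open>k * t\<close>. The gap is at most
      \<open>B\<close>, since \<open>k - q * B = r + 1\<close>.\<close>
    have "real q * (interpolate B g ?j - real k)
        = t * (real k - real q * real B) + (g (q + 1) - real k * t - g (q - 1))"
      using q0 unfolding 1 interpolate_def by (simp add: field_simps kt)
    moreover have "\<bar>t * (real k - real q * real B)\<bar> \<le> 1 * real B"
      unfolding abs_mult using t rB kt tB by (intro mult_mono) auto
    ultimately have "\<bar>real q * (interpolate B g ?j - real k)\<bar> \<le> real B + 2 * E"
      using n1 n2 by linarith
    then have "\<bar>interpolate B g ?j - real k\<bar> * real q \<le> real B + 2 * E"
      unfolding abs_mult abs_of_nat by (simp only: mult.commute)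
    then show ?thesis using q0 by (simp only: pos_le_divide_eq)
  next
    case 2
    have q0: "real q > 0" using q by simp
    have n1: "\<bar>g q - real k * (1 - t)\<bar> \<le> E" using near[of "q"] by (simp add: peak_def t_def)
    have n2: "\<bar>g (q + 2)\<bar> \<le> E" using near[of "q + 2"] q by (simp add: peak_def)
    \<comment> \<open>The mirror image: the distance is measured back from
      \<open>(q + 1) * B\<close>, and \<open>1 - t\<close> replaces \<open>t\<close>.\<close>
    have "real (q + 1) * (interpolate B g ?j - real k)
        = (1 - t) * (real (q + 1) * real B - real k) + (g (q + 2) - (g q - real k * (1 - t)))"
      using q0 unfolding 2 interpolate_def by (simp add: field_simps kt)
    moreover have "\<bar>(1 - t) * (real (q + 1) * real B - real k)\<bar> \<le> 1 * real B"
      unfolding abs_mult using t rB kt tB by (intro mult_mono) (auto simp: algebra_simps)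
    ultimately have "\<bar>real (q + 1) * (interpolate B g ?j - real k)\<bar> \<le> real B + 2 * E"
      using n1 n2 by linarith
    then have "\<bar>interpolate B g ?j - real k\<bar> * real (q + 1) \<le> real B + 2 * E"
      unfolding abs_mult abs_of_nat by (simp only: mult.commute)
    then have "\<bar>interpolate B g ?j - real k\<bar> \<le> (real B + 2 * E) / real (q + 1)"
      by (subst pos_le_divide_eq) simp_all
    also have "\<dots> \<le> (real B + 2 * E) / real q"
      using q0 E B by (intro divide_left_mono) auto
    finally show ?thesis .
  qed
qed

section \<open>Measurability of the decoder\<close>

lemma measurable_stat [measurable]:
  "(\<lambda>y. stat S n y j) \<in> borel_measurable (PiM {0..<n} (\<lambda>_. borel))"
  unfolding stat_def by (intro borel_measurable_sum borel_measurable_times) auto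

text \<open>The index of the peak depends on the data but is measurable and has countably many
  values, so it is enough to treat each fixed index.\<close>

lemma measurable_estimate [measurable]:
  "estimate S n B \<in> borel_measurable (PiM {0..<n} (\<lambda>_. borel))"
proof -
  have [measurable]: "(\<lambda>y. argmax (2 * B) (stat S n y)) \<in> measurable (PiM {0..<n} (\<lambda>_. borel)) (count_space UNIV)"
  proof -
    have [measurable]: "Measurable.pred (PiM {0..<n} (\<lambda>_. borel)) (\<lambda>y. stat S n y j' \<le> stat S n y j)" for j j'
      unfolding pred_def by (intro borel_measurable_le measurable_stat)
    show ?thesis unfolding argmax_def by measurable
  qed
  have "(\<lambda>y. interpolate B (stat S n y) (argmax (2 * B) (stat S n y)))
      \<in> borel_measurable (PiM {0..<n} (\<lambda>_. borel))"
  proof (rule measurable_compose_countable)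
    show "(\<lambda>y. interpolate B (stat S n y) j) \<in> borel_measurable (PiM {0..<n} (\<lambda>_. borel))" for j
      unfolding interpolate_def by measurable
  qed measurable
  then show ?thesis unfolding estimate_def .
qed

section \<open>Probability of good signs and of small noise\<close>

lemma measure_UNION_le_card:
  assumes "finite J" "\<And>j. j \<in> J \<Longrightarrow> F j \<in> sets M" "\<And>j. j \<in> J \<Longrightarrow> measure M (F j) \<le> p"
    "real (card J) \<le> c" "p \<ge> 0"
  shows "measure M (\<Union>j\<in>J. F j) \<le> c * p"
proof -
  have "measure M (\<Union>j\<in>J. F j) \<le> (\<Sum>j\<in>J. measure M (F j))"
    using assms by (intro measure_UNION_le) auto
  also have "\<dots> \<le> real (card J) * p"
    using assms(3) by (rule sum_bounded_above)
  also have "\<dots> \<le> c * p"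
    using assms by (intro mult_right_mono) auto
  finally show ?thesis .
qed

text \<open>Two scales: a weak bound at all columns locates the peak, and a strong bound at the four
  columns around it gives the accuracy. Removing \<open>Id\<close> excludes the diagonal, where the
  correlation is \<open>card K\<close>.\<close>

definition well_spread :: "nat \<Rightarrow> nat \<Rightarrow> nat set \<Rightarrow> nat \<Rightarrow> nat set \<Rightarrow> bool" where
  "well_spread n m K q S \<longleftrightarrow>
     (\<forall>(j, j')\<in>{1..m} \<times> {q, q + 1} - Id. \<bar>corr S K j j'\<bar> < real n / 200) \<and>
     (\<forall>(j, j')\<in>{q - 1..q + 2} \<times> {q, q + 1} - Id. \<bar>corr S K j j'\<bar> < 10 * sqrt (real n))"

definition noise :: "nat set \<Rightarrow> nat \<Rightarrow> (nat \<Rightarrow> real) \<Rightarrow> (nat \<Rightarrow> real) \<Rightarrow> nat \<Rightarrow> real" where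
  "noise S n \<mu> y j = (\<Sum>i<n. sign_bit S i j * (y i - \<mu> i))"

text \<open>At the weak scale each pair fails with probability \<open>O(1 / n)\<close>, which
  survives a union over \<open>O(sqrt n)\<close> pairs. At the strong scale each of at most 8 pairs
  fails with probability at most \<open>1 / 100\<close>.\<close>

lemma prob_well_spread:
  assumes n: "sqrt (real n) \<ge> 2 * 10^7" and m: "real m \<le> 4 * sqrt (real n)"
    and K: "K \<subseteq> {0..<n}" and q: "q \<ge> 2" "q + 2 \<le> m"
  shows "measure_pmf.prob (pmf_of_set (Pow (prod_encode ` ({0..<n} \<times> {0..m})))) {S. well_spread n m K q S} \<ge> 9 / 10"
proof -
  let ?A = "prod_encode ` ({0..<n} \<times> {0..m})"
  let ?p = "pmf_of_set (Pow ?A)"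
  let ?J1 = "{1..m} \<times> {q, q + 1} - Id" and ?J2 = "{q - 1..q + 2} \<times> {q, q + 1} - Id"
  let ?F = "\<lambda>T (j, j'). {S. T \<le> \<bar>corr S K j j'\<bar>}"
  have n0: "real n > 0" using n by (cases "n = 0") auto
  have K': "finite K" "real (card K) \<le> real n"
    using K card_mono[OF _ K] by (auto intro: finite_subset)
  have prob: "measure_pmf.prob ?p (?F T x) \<le> real n / T\<^sup>2" if "x \<in> ?J1 \<union> ?J2" "T > 0" for T x
  proof -
    obtain j j' where x: "x = (j, j')" by (cases x)
    have "measure_pmf.prob ?p {S. T \<le> \<bar>corr S K j j'\<bar>} \<le> real (card K) / T\<^sup>2"
      using that K q by (intro prob_corr_ge K') (auto simp: x)
    also have "\<dots> \<le> real n / T\<^sup>2" using K' by (intro divide_right_mono) auto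
    finally show ?thesis by (simp add: x)
  qed
  have card1: "real (card ?J1) \<le> 2 * real m"
  proof -
    have "card ?J1 \<le> card ({1..m} \<times> {q, q + 1})" by (intro card_mono) auto
    then show ?thesis by (simp add: card_cartesian_product)
  qed
  have card2: "real (card ?J2) \<le> 8"
  proof -
    have "card ?J2 \<le> card ({q - 1..q + 2} \<times> {q, q + 1})" by (intro card_mono) auto
    also have "\<dots> = 8" using q by (simp add: card_cartesian_product)
    finally show ?thesis by simp
  qed
  have "measure_pmf.prob ?p {S. \<not> well_spread n m K q S}
      \<le> measure_pmf.prob ?p ((\<Union>x\<in>?J1. ?F (real n / 200) x) \<union> (\<Union>x\<in>?J2. ?F (10 * sqrt (real n)) x))"
    by (intro measure_pmf.finite_measure_mono) (auto simp: well_spread_def not_less)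
  also have "\<dots> \<le> measure_pmf.prob ?p (\<Union>x\<in>?J1. ?F (real n / 200) x)
      + measure_pmf.prob ?p (\<Union>x\<in>?J2. ?F (10 * sqrt (real n)) x)"
    by (intro measure_Un_le) auto
  also have "\<dots> \<le> 2 * real m * (real n / (real n / 200)\<^sup>2) + 8 * (real n / (10 * sqrt (real n))\<^sup>2)"
    using n0 by (intro add_mono measure_UNION_le_card card1 card2 prob) auto
  also have "2 * real m * (real n / (real n / 200)\<^sup>2) = 80000 * (real m / real n)"
    using n0 by (simp add: field_simps power2_eq_square)
  also have "real m / real n \<le> 4 * sqrt (real n) / real n"
    using m by (intro divide_right_mono) auto
  also have "4 * sqrt (real n) / real n = 4 / sqrt (real n)"
    using n0 by (simp add: field_simps)
  \<comment> \<open>This makes the first term at most 0.016; with 0.08 from the second the total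
    stays below \<open>1 / 10\<close>.\<close>
  also have "4 / sqrt (real n) \<le> 4 / (2 * 10^7)"
    using n n0 by (intro divide_left_mono) auto
  also have "8 * (real n / (10 * sqrt (real n))\<^sup>2) = 8 / 100"
    using n0 by (simp add: power_mult_distrib)
  finally have "measure_pmf.prob ?p {S. \<not> well_spread n m K q S} \<le> 1 / 10"
    by simp
  moreover have "measure_pmf.prob ?p {S. \<not> well_spread n m K q S} = 1 - measure_pmf.prob ?p {S. well_spread n m K q S}"
    using measure_pmf.prob_compl[of "{S. well_spread n m K q S}" ?p] by (simp add: Compl_eq_Diff_UNIV[symmetric] Collect_neg_eq)
  ultimately show ?thesis by simp
qed

text \<open>The signs are fixed here. The bound on \<open>\<sigma>\<^sup>2 * ln n\<close> makes the
  tail at \<open>n / 200\<close> at most \<open>2 / n\<close>, small enough for a union over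
  \<open>O(sqrt n)\<close> columns; near the peak only four columns are needed, each with tail
  \<open>2 * exp (- 8)\<close>.\<close>

lemma prob_small_noise:
  assumes n: "sqrt (real n) \<ge> 2 * 10^7" and m: "real m \<le> 4 * sqrt (real n)" and q: "q \<ge> 1"
    and \<sigma>: "\<sigma> > 0" "80000 * \<sigma>\<^sup>2 * ln (real n) \<le> real n"
  shows "measure (gauss_prod \<mu> \<sigma> {0..<n}) {y \<in> space (gauss_prod \<mu> \<sigma> {0..<n}).
      (\<forall>j\<in>{1..m}. \<bar>noise S n \<mu> y j\<bar> < real n / 200) \<and>
      (\<forall>j\<in>{q - 1..q + 2}. \<bar>noise S n \<mu> y j\<bar> < 4 * \<sigma> * sqrt (real n))} \<ge> 9 / 10"
    (is "measure ?M ?G \<ge> _")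
proof -
  interpret prob_space ?M by (rule prob_space_gauss_prod[OF \<sigma>(1)])
  let ?F = "\<lambda>T j. {y \<in> space ?M. T \<le> \<bar>noise S n \<mu> y j\<bar>}"
  have n0: "real n > 0" using n by (cases "n = 0") auto
  have [measurable]: "(\<lambda>y. noise S n \<mu> y j) \<in> borel_measurable (PiM {0..<n} (\<lambda>_. borel))" for j
    unfolding noise_def
    by (intro borel_measurable_sum borel_measurable_times borel_measurable_diff) auto
  have F[measurable]: "?F T j \<in> sets ?M" for T j by measurable
  have prob: "measure ?M (?F T j) \<le> 2 * exp (- T\<^sup>2 / (2 * \<sigma>\<^sup>2 * real n))" if "T \<ge> 0" for T j
    unfolding noise_def lessThan_atLeast0 using that \<sigma>(1) n0 sum_sign_bit_square_le[of S j n]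
    by (intro gauss_prod_tail_abs) (auto simp: lessThan_atLeast0)
  have far: "measure ?M (?F (real n / 200) j) \<le> 2 / real n" for j
  proof -
    have "measure ?M (?F (real n / 200) j) \<le> 2 * exp (- (real n / 200)\<^sup>2 / (2 * \<sigma>\<^sup>2 * real n))"
      by (rule prob) simp
    also have "- (real n / 200)\<^sup>2 / (2 * \<sigma>\<^sup>2 * real n) = - (real n / (80000 * \<sigma>\<^sup>2))"
      using n0 \<sigma>(1) by (simp add: field_simps power2_eq_square)
    also have "exp \<dots> \<le> exp (- ln (real n))"
      using \<sigma> by (simp add: field_simps)
    also have "exp (- ln (real n)) = 1 / real n"
      using n0 by (simp add: exp_minus inverse_eq_divide)
    finally show ?thesis by simp
  qed
  have near: "measure ?M (?F (4 * \<sigma> * sqrt (real n)) j) \<le> 2 / 256" for j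
  proof -
    have "measure ?M (?F (4 * \<sigma> * sqrt (real n)) j) \<le> 2 * exp (- (4 * \<sigma> * sqrt (real n))\<^sup>2 / (2 * \<sigma>\<^sup>2 * real n))"
      using \<sigma>(1) by (intro prob) simp
    also have "- (4 * \<sigma> * sqrt (real n))\<^sup>2 / (2 * \<sigma>\<^sup>2 * real n) = - 8"
      using n0 \<sigma>(1) by (simp add: field_simps power_mult_distrib)
    also have "exp (- 8 :: real) \<le> 1 / 256"
    proof -
      have "(2::real) ^ 8 \<le> exp 1 ^ 8"
        using exp_ge_add_one_self[of 1] by (intro power_mono) auto
      then have "256 \<le> exp (8::real)" by (simp flip: exp_of_nat_mult)
      then show ?thesis by (simp add: exp_minus field_simps)
    qed
    finally show ?thesis by simp
  qed
  have G[measurable]: "?G \<in> sets ?M" by measurable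
  have "measure ?M (space ?M - ?G)
      \<le> measure ?M ((\<Union>j\<in>{1..m}. ?F (real n / 200) j) \<union> (\<Union>j\<in>{q - 1..q + 2}. ?F (4 * \<sigma> * sqrt (real n)) j))"
    by (intro finite_measure_mono) (auto simp: not_less)
  also have "\<dots> \<le> measure ?M (\<Union>j\<in>{1..m}. ?F (real n / 200) j)
      + measure ?M (\<Union>j\<in>{q - 1..q + 2}. ?F (4 * \<sigma> * sqrt (real n)) j)"
    by (intro measure_Un_le) auto
  also have "\<dots> \<le> real m * (2 / real n) + 4 * (2 / 256)"
    using q by (intro add_mono measure_UNION_le_card far near) auto
  also have "real m * (2 / real n) \<le> 4 * sqrt (real n) * (2 / real n)"
    using m by (intro mult_right_mono) auto
  also have "4 * sqrt (real n) * (2 / real n) = 8 / sqrt (real n)"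
    using n0 by (simp add: field_simps)
  also have "8 / sqrt (real n) \<le> 8 / (2 * 10^7)"
    using n n0 by (intro divide_left_mono) auto
  finally have "measure ?M (space ?M - ?G) \<le> 1 / 10" by simp
  then show ?thesis using prob_compl[OF G] by simp
qed

text \<open>On the two good events the error is bounded deterministically: cross-correlations and
  noise together are the deviations fed to the decoder.\<close>

lemma estimate_error:
  fixes K :: "nat set"
  defines "k \<equiv> card K"
  assumes K: "K \<subseteq> {0..<n}" "real k \<ge> real n / 10" and k: "k = q * B + r + 1" "r < B"
    and q: "q \<ge> 2" "q + 2 \<le> 2 * B" and n: "n > 0"
    and \<mu>: "\<And>i. i < n \<Longrightarrow> \<mu> i = (if i \<in> K then profile S B i (k - 1) else 0)"
    and S: "well_spread n (2 * B) K q S"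
    and y: "\<forall>j\<in>{1..2 * B}. \<bar>noise S n \<mu> y j\<bar> < real n / 200"
      "\<forall>j\<in>{q - 1..q + 2}. \<bar>noise S n \<mu> y j\<bar> < 4 * \<sigma> * sqrt (real n)"
  shows "\<bar>estimate S n B y - real k\<bar> \<le> (real B + 2 * (10 * sqrt (real n) + 4 * \<sigma> * sqrt (real n))) / real q"
proof -
  define t where "t = real r / real B"
  have B: "real B > 0" using k by simp
  have t: "0 \<le> t" "t \<le> 1" using k by (auto simp: t_def)
  have dq: "(k - 1) div B = q" "(k - 1) mod B = r" using k by auto
  define peak where "peak = (\<lambda>j. if j = q then real k * (1 - real r / real B)
                     else if j = q + 1 then real k * (real r / real B) else 0)"
  have stat: "stat S n y j = (1 - t) * corr S K j q + t * corr S K j (q + 1) + noise S n \<mu> y j" for j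
  proof -
    have "stat S n y j = (\<Sum>i<n. sign_bit S i j * \<mu> i) + noise S n \<mu> y j"
      by (simp add: stat_def noise_def sum.distrib[symmetric] algebra_simps)
    \<comment> \<open>Isolated nodes drop out, and all nodes of \<open>K\<close> share the degree
      \<open>k - 1\<close>, hence the same \<open>q\<close> and \<open>t\<close>.\<close>
    also have "(\<Sum>i<n. sign_bit S i j * \<mu> i) = (\<Sum>i\<in>K. sign_bit S i j * profile S B i (k - 1))"
      using K(1) by (intro sum.mono_neutral_cong_right) (auto simp: \<mu>)
    also have "\<dots> = (1 - t) * corr S K j q + t * corr S K j (q + 1)"
      unfolding corr_def sum_distrib_left sum.distrib[symmetric]
      by (intro sum.cong refl) (simp add: profile_def dq t_def algebra_simps del: One_nat_def)
    finally show ?thesis .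
  qed
  have diag: "corr S K j j = real k" if "j > 0" for j
    using that by (simp add: corr_def k_def sign_bit_square flip: power2_eq_square)
  have dev: "\<bar>stat S n y j - peak j\<bar> \<le> T + \<bar>noise S n \<mu> y j\<bar>"
    if "\<And>j'. j' \<in> {q, q + 1} \<Longrightarrow> j \<noteq> j' \<Longrightarrow> \<bar>corr S K j j'\<bar> \<le> T" "T \<ge> 0" for j T
  proof -
    \<comment> \<open>Diagonal correlations equal \<open>k\<close> and make up \<open>peak\<close>
      exactly, so they are replaced by 0; a convex combination of off-diagonal ones remains.\<close>
    have "\<bar>(1 - t) * (if j = q then 0 else corr S K j q) + t * (if j = q + 1 then 0 else corr S K j (q + 1))\<bar> \<le> T"
      using that by (intro abs_convex_le t) auto
    moreover have "stat S n y j - peak j = (1 - t) * (if j = q then 0 else corr S K j q)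
        + t * (if j = q + 1 then 0 else corr S K j (q + 1)) + noise S n \<mu> y j"
      using diag[of q] diag[of "q + 1"] q by (auto simp: stat peak_def t_def algebra_simps)
    ultimately show ?thesis by linarith
  qed
  have "\<bar>interpolate B (stat S n y) (argmax (2 * B) (stat S n y)) - real k\<bar>
      \<le> (real B + 2 * (10 * sqrt (real n) + 4 * \<sigma> * sqrt (real n))) / real q"
  proof (rule interpolate_argmax_error[OF k q peak_def])
    fix j assume j: "j \<in> {1..2 * B}"
    have "\<bar>stat S n y j - peak j\<bar> \<le> real n / 200 + \<bar>noise S n \<mu> y j\<bar>"
      using S j by (intro dev) (auto simp: well_spread_def intro!: less_imp_le)
    also have "\<dots> < real n / 200 + real n / 200" using y(1)[rule_format, OF j] by linarith
    \<comment> \<open>Here \<open>n / 100\<close> is compared with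
      \<open>k / 4 \<ge> n / 40\<close>.\<close>
    also have "\<dots> \<le> real k / 4" using K(2) n by simp
    finally show "\<bar>stat S n y j - peak j\<bar> < real k / 4" .
  next
    fix j assume j: "j \<in> {q - 1..q + 2}"
    have "\<bar>stat S n y j - peak j\<bar> \<le> 10 * sqrt (real n) + \<bar>noise S n \<mu> y j\<bar>"
      using S j by (intro dev) (auto simp: well_spread_def intro!: less_imp_le)
    also have "\<dots> \<le> 10 * sqrt (real n) + 4 * \<sigma> * sqrt (real n)" using y(2) j by force
    finally show "\<bar>stat S n y j - peak j\<bar> \<le> 10 * sqrt (real n) + 4 * \<sigma> * sqrt (real n)" .
  qed
  then show ?thesis by (simp add: estimate_def)
qed

section \<open>The private algorithm\<close>

text \<open>The postprocessing does not receive the public string \<open>r\<close>, so every output carries it in its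
  integer part, and the noisy value is squeezed into the fractional part.\<close>

definition encode :: "nat \<Rightarrow> real \<Rightarrow> real" where
  "encode r y = real r + (1 / 2 + arctan y / pi)"

definition decode :: "real \<Rightarrow> real" where
  "decode x = tan (pi * (frac x - 1 / 2))"

lemma floor_encode [simp]: "\<lfloor>encode r y\<rfloor> = int r"
proof -
  define t where "t = arctan y / pi"
  have "- 1 / 2 < t" "t < 1 / 2"
    using arctan_bounded[of y] by (simp_all add: t_def field_simps)
  then show ?thesis unfolding encode_def t_def[symmetric] by (intro floor_unique) auto
qed

lemma decode_encode [simp]: "decode (encode r y) = y"
  unfolding decode_def frac_def floor_encode by (simp add: encode_def tan_arctan)

lemma measurable_encode [measurable]: "encode r \<in> borel_measurable borel"
  unfolding encode_def by (intro borel_measurable_continuous_onI continuous_intros) auto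

lemma measurable_decode [measurable]: "decode \<in> borel_measurable borel"
proof -
  have "decode = (\<lambda>x. sin (pi * (x - of_int \<lfloor>x\<rfloor> - 1 / 2)) / cos (pi * (x - of_int \<lfloor>x\<rfloor> - 1 / 2)))"
    by (simp add: decode_def tan_def frac_def fun_eq_iff)
  also have "\<dots> \<in> borel_measurable borel" by measurable
  finally show ?thesis .
qed

definition randomizer :: "nat \<Rightarrow> real \<Rightarrow> nat \<Rightarrow> nat \<Rightarrow> nat set \<Rightarrow> real measure" where
  "randomizer B \<sigma> i r N =
     distr (density lborel (normal_density (profile (set_decode r) B i (card N)) \<sigma>)) borel (encode r)"

text \<open>Every coordinate carries the public string, and coordinate 0 is the one read. The
  restriction to \<open>{0..<n}\<close> keeps the decoded vector in the product space.\<close>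

definition postprocess :: "nat \<Rightarrow> nat \<Rightarrow> (nat \<Rightarrow> real) \<Rightarrow> real" where
  "postprocess n B x = estimate (set_decode (nat \<lfloor>x 0\<rfloor>)) n B (\<lambda>i\<in>{0..<n}. decode (x i))"

definition means :: "nat \<Rightarrow> nat \<Rightarrow> (nat \<times> nat) set \<Rightarrow> nat \<Rightarrow> real" where
  "means B r G i = profile (set_decode r) B i (card (nbhd G i))"

lemma prob_space_randomizer: "\<sigma> > 0 \<Longrightarrow> prob_space (randomizer B \<sigma> i r N)"
  unfolding randomizer_def
  by (intro prob_space.prob_space_distr prob_space_normal_density) auto

lemma sets_randomizer [simp]: "sets (randomizer B \<sigma> i r N) = sets borel"
  by (simp add: randomizer_def)

lemma measurable_compose_encode:
  "compose I (encode r) \<in> measurable (gauss_prod \<mu> \<sigma> I) (PiM I (\<lambda>_. borel))"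
  unfolding compose_def by measurable

text \<open>Coordinatewise pushforward commutes with the product, so privacy and accuracy can both
  be checked on unencoded Gaussian vectors.\<close>

lemma outputs_randomizer:
  assumes "\<sigma> > 0"
  shows "outputs n (randomizer B \<sigma>) r G
    = distr (gauss_prod (means B r G) \<sigma> {0..<n}) (PiM {0..<n} (\<lambda>_. borel)) (compose {0..<n} (encode r))"
proof -
  let ?D = "\<lambda>i. density lborel (normal_density (means B r G i) \<sigma>)"
  have ps: "prob_space (distr (?D i) borel (encode r))" for i
    using assms by (intro prob_space.prob_space_distr prob_space_normal_density) auto
  \<comment> \<open>\<open>distr_PiM_finite_prob_space'\<close> needs probability spaces as targets, so \<open>borel\<close> is replaced\<close>
  have "outputs n (randomizer B \<sigma>) r G = PiM {0..<n} (\<lambda>i. distr (?D i) (distr (?D i) borel (encode r)) (encode r))"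
    unfolding outputs_def randomizer_def means_def by (intro PiM_cong distr_cong) auto
  also have "\<dots> = distr (PiM {0..<n} ?D) (PiM {0..<n} (\<lambda>i. distr (?D i) borel (encode r))) (compose {0..<n} (encode r))"
    using assms by (intro distr_PiM_finite_prob_space'[symmetric] ps prob_space_normal_density) auto
  also have "\<dots> = distr (gauss_prod (means B r G) \<sigma> {0..<n}) (PiM {0..<n} (\<lambda>_. borel)) (compose {0..<n} (encode r))"
    unfolding gauss_prod_def by (intro distr_cong sets_PiM_cong) auto
  finally show ?thesis .
qed

lemma measurable_postprocess [measurable]:
  assumes "n > 0"
  shows "postprocess n B \<in> borel_measurable (PiM {0..<n} (\<lambda>_. borel))"
proof -
  have [measurable]: "(\<lambda>x. x 0) \<in> measurable (PiM {0..<n} (\<lambda>_. borel :: real measure)) borel"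
    using assms by (intro measurable_component_singleton) auto
  have [measurable]: "(\<lambda>x. \<lambda>i\<in>{0..<n}. decode (x i)) \<in> measurable (PiM {0..<n} (\<lambda>_. borel)) (PiM {0..<n} (\<lambda>_. borel))"
    by measurable
  have "(\<lambda>x. estimate (set_decode (nat \<lfloor>x 0\<rfloor>)) n B (\<lambda>i\<in>{0..<n}. decode (x i)))
      \<in> borel_measurable (PiM {0..<n} (\<lambda>_. borel))"
    by (rule measurable_compose_countable[where g = "\<lambda>x. nat \<lfloor>x 0\<rfloor>"]) measurable
  then show ?thesis unfolding postprocess_def .
qed

lemma postprocess_encode:
  assumes "n > 0"
  shows "postprocess n B (compose {0..<n} (encode r) y) = estimate (set_decode r) n B y"
  using assms unfolding postprocess_def estimate_def
  by (auto simp: stat_def fun_eq_iff compose_def intro!: arg_cong2[where f = "interpolate B"] arg_cong[where f = "argmax (2 * B)"] sum.cong)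

section \<open>Privacy of the algorithm\<close>

text \<open>For every public string, the changed node contributes at most 4 to the squared distance
  of the means and the others at most \<open>n * (2 / B)\<^sup>2 \<le> 4\<close>. With
  \<open>D = 8\<close> the factor \<open>8 * D\<close> of the mechanism is the 64 in
  \<open>\<sigma>\<^sup>2\<close>.\<close>

lemma is_LNDP_randomizer:
  assumes \<epsilon>: "0 < \<epsilon>" "\<epsilon> \<le> 1" and \<delta>: "0 < \<delta>" "\<delta> \<le> 1/2" and B: "B > 0" "real n \<le> (real B)\<^sup>2" and n: "n > 0"
    and \<sigma>: "\<sigma> > 0" "\<sigma>\<^sup>2 = 64 * ln (1/\<delta>) / \<epsilon>\<^sup>2"
  shows "is_LNDP n \<epsilon> \<delta> \<rho> (randomizer B \<sigma>) (postprocess n B)"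
proof -
  have "indist \<epsilon> \<delta> (outputs n (randomizer B \<sigma>) r G) (outputs n (randomizer B \<sigma>) r G')"
    if nn: "node_neighbors n G G'" for r G G'
  proof -
    obtain v where v: "v < n" "\<And>i j. i \<noteq> v \<Longrightarrow> j \<noteq> v \<Longrightarrow> (i, j) \<in> G \<longleftrightarrow> (i, j) \<in> G'"
      using nn unfolding node_neighbors_def by blast
    have fin: "finite (nbhd G i)" "finite (nbhd G' i)" for i
      using nn unfolding node_neighbors_def graph_on_def nbhd_def
      by (auto intro!: finite_subset[of _ "{0..<n}"])
    have diff: "(means B r G i - means B r G' i)\<^sup>2 \<le> (2 / real B)\<^sup>2" if "i \<noteq> v" for i
    proof -
      \<comment> \<open>Both neighbourhoods agree apart from \<open>v\<close>, so the degrees differ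
        by at most 1.\<close>
      have rem: "nbhd G i - {v} = nbhd G' i - {v}"
        using v(2) that by (auto simp: nbhd_def)
      have c: "card (nbhd H i) = card (nbhd H i - {v}) \<or> card (nbhd H i) = Suc (card (nbhd H i - {v}))"
        if "finite (nbhd H i)" for H
        using that card_Suc_Diff1[of "nbhd H i" v]
        by (cases "v \<in> nbhd H i") (simp_all del: card_Diff_singleton)
      have "card (nbhd G i) = card (nbhd G' i) \<or> card (nbhd G i) = Suc (card (nbhd G' i))
          \<or> card (nbhd G' i) = Suc (card (nbhd G i))"
        using c[OF fin(1)] c[OF fin(2)] unfolding rem by presburger
      then have "\<bar>means B r G i - means B r G' i\<bar> \<le> 2 / real B"
        using profile_Suc_diff[OF B(1), of "set_decode r" i] by (auto simp: means_def abs_minus_commute)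
      then show ?thesis by (simp add: abs_le_square_iff[symmetric])
    qed
    have "\<bar>means B r G v - means B r G' v\<bar> \<le> 2"
      using profile_abs_le[OF B(1), of "set_decode r" v "card (nbhd G v)"]
        profile_abs_le[OF B(1), of "set_decode r" v "card (nbhd G' v)"] by (simp add: means_def)
    then have diffv: "(means B r G v - means B r G' v)\<^sup>2 \<le> 2\<^sup>2"
      by (subst abs_le_square_iff[symmetric]) simp
    have "(\<Sum>i\<in>{0..<n}. (means B r G i - means B r G' i)\<^sup>2)
        = (means B r G v - means B r G' v)\<^sup>2 + (\<Sum>i\<in>{0..<n} - {v}. (means B r G i - means B r G' i)\<^sup>2)"
      using v(1) by (intro sum.remove) auto
    also have "\<dots> \<le> 2\<^sup>2 + real (card ({0..<n} - {v})) * (2 / real B)\<^sup>2"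
      using diff by (intro add_mono diffv sum_bounded_above) auto
    also have "\<dots> \<le> 2\<^sup>2 + real n * (2 / real B)\<^sup>2"
      using v(1) by (intro add_mono mult_right_mono) auto
    also have "\<dots> \<le> 8"
      using B by (simp add: field_simps power_divide)
    finally have "indist \<epsilon> \<delta> (gauss_prod (means B r G) \<sigma> {0..<n}) (gauss_prod (means B r G') \<sigma> {0..<n})"
      using \<epsilon> \<delta> \<sigma> by (intro gaussian_mechanism[where D = 8]) auto
    then show ?thesis
      unfolding outputs_randomizer[OF \<sigma>(1)] by (rule indist_distr[OF _ measurable_compose_encode])
  qed
  then show ?thesis
    unfolding is_LNDP_def using n \<sigma>(1)
    by (auto intro: prob_space_randomizer measurable_postprocess)
qed

lemma measure_alg_out:
  assumes "\<sigma> > 0" "n > 0" and Y[measurable]: "Y \<in> sets borel"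
  shows "measure (alg_out n (randomizer B \<sigma>) (postprocess n B) r G) Y
    = measure (gauss_prod (means B r G) \<sigma> {0..<n})
        {y \<in> space (gauss_prod (means B r G) \<sigma> {0..<n}). estimate (set_decode r) n B y \<in> Y}"
proof -
  note [measurable] = measurable_postprocess[OF assms(2)] measurable_compose_encode
  have "alg_out n (randomizer B \<sigma>) (postprocess n B) r G
      = distr (gauss_prod (means B r G) \<sigma> {0..<n}) borel (\<lambda>y. estimate (set_decode r) n B y)"
    unfolding alg_out_def outputs_randomizer[OF assms(1)]
    by (subst distr_distr) (auto simp: comp_def postprocess_encode[OF assms(2)])
  then show ?thesis
    by (simp add: measure_distr vimage_def Int_def conj_commute)
qed

section \<open>Accuracy on cliques\<close>

lemma nbhd_clique_graph: "nbhd (clique_graph K) i = (if i \<in> K then K - {i} else {})"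
  by (auto simp: nbhd_def clique_graph_def)

text \<open>The signs are good with probability at least \<open>9 / 10\<close>, and for each good
  choice the noise is small with probability at least \<open>9 / 10\<close>; averaging over the
  public string multiplies the two.\<close>

lemma alg_prob_clique:
  fixes K :: "nat set"
  defines "k \<equiv> card K"
  assumes n: "sqrt (real n) \<ge> 2 * 10^7" and B: "sqrt (real n) \<le> real B" "real B \<le> 2 * sqrt (real n)"
    and K: "K \<subseteq> {0..<n}" "real k \<ge> real n / 10"
    and \<sigma>: "\<sigma> > 0" "80000 * \<sigma>\<^sup>2 * ln (real n) \<le> real n"
    and w: "880 + 320 * \<sigma> \<le> w"
  shows "alg_prob n (map_pmf set_encode (pmf_of_set (Pow (prod_encode ` ({0..<n} \<times> {0..2 * B})))))
      (randomizer B \<sigma>) (postprocess n B) (clique_graph K) {x. \<bar>x - real k\<bar> \<le> w} \<ge> 2 / 3"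
proof -
  let ?A = "prod_encode ` ({0..<n} \<times> {0..2 * B})"
  let ?p = "pmf_of_set (Pow ?A)"
  define s where "s = sqrt (real n)"
  have s: "s \<ge> 2 * 10^7" "real n = s * s" using n by (auto simp: s_def)
  have n0: "n > 0" using n by (cases "n = 0") auto
  have B0: "B > 0" using B n by (cases "B = 0") auto
  have finK: "finite K" using K(1) by (rule finite_subset) simp
  have kn: "real k \<le> real n" using card_mono[OF _ K(1)] by (simp add: k_def)
  have k0: "k \<ge> 1" using K(2) n0 by (cases k) auto
  define q r where "q = (k - 1) div B" and "r = (k - 1) mod B"
  have k: "k = q * B + r + 1" "r < B" using k0 B0 by (auto simp: q_def r_def)
  \<comment> \<open>This leads to \<open>q < B\<close>, so that the search range
    \<open>{1..2 * B}\<close> contains both peaks and \<open>q + 2\<close>.\<close>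
  have "real q * real B < s * s"
  proof -
    have "real q * real B < real k" unfolding k(1) by simp
    then show ?thesis using kn s(2) by simp
  qed
  also have "s * s \<le> real B * real B"
    using B(1) by (intro mult_mono) (auto simp: s_def)
  finally have "q < B" using B0 by simp
  \<comment> \<open>Since \<open>k \<ge> n / 10\<close> and blocks have length at most
    \<open>2 * sqrt n\<close>, the divisor \<open>q\<close> in the error bound has order
    \<open>sqrt n\<close>.\<close>
  moreover have qs: "real q \<ge> s / 40"
  proof -
    have "s * s / 10 \<le> real q * real B + real r + 1"
      using K(2) k(1) s(2) by simp
    also have "\<dots> \<le> (real q + 1) * real B" using k(2) by (simp add: algebra_simps)
    also have "\<dots> \<le> (real q + 1) * (2 * s)" using B(2) by (intro mult_left_mono) (auto simp: s_def)
    finally have "s * s \<le> s * (20 * (real q + 1))" by (simp add: algebra_simps)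
    then have "s \<le> 20 * (real q + 1)" by (rule mult_left_le_imp_le) (use s(1) in simp)
    then show ?thesis using s(1) by simp
  qed
  moreover have "B \<ge> 2" using B(1) s(1) by (simp add: s_def)
  ultimately have q: "q \<ge> 2" "q + 2 \<le> 2 * B" using s(1) by auto
  have m: "real (2 * B) \<le> 4 * sqrt (real n)" using B(2) by simp
  have err: "(real B + 2 * (10 * sqrt (real n) + 4 * \<sigma> * sqrt (real n))) / real q \<le> w"
  proof -
    have "(real B + 2 * (10 * s + 4 * \<sigma> * s)) / real q \<le> (2 * s + 2 * (10 * s + 4 * \<sigma> * s)) / (s / 40)"
      using B(2) s(1) \<sigma>(1) qs by (intro frac_le add_mono mult_nonneg_nonneg) (auto simp flip: s_def)
    also have "\<dots> = 880 + 320 * \<sigma>" using s(1) by (simp add: field_simps)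
    finally show ?thesis using w by (simp add: s_def)
  qed
  have Y: "{x. \<bar>x - real k\<bar> \<le> w} \<in> sets borel" by measurable
  let ?f = "\<lambda>r. measure (alg_out n (randomizer B \<sigma>) (postprocess n B) r (clique_graph K)) {x. \<bar>x - real k\<bar> \<le> w}"
  have fin: "finite (set_pmf ?p)"
    by (subst set_pmf_of_set) auto
  have good: "?f (set_encode S) \<ge> 9 / 10" if "S \<in> set_pmf ?p" "well_spread n (2 * B) K q S" for S
  proof -
    \<comment> \<open>Finiteness is what makes \<open>set_decode\<close> invert
      \<open>set_encode\<close>.\<close>
    have "finite S" using that(1) by (subst (asm) set_pmf_of_set) (auto intro: finite_subset)
    then have dS: "set_decode (set_encode S) = S" by simp
    let ?\<mu> = "means B (set_encode S) (clique_graph K)"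
    let ?M = "gauss_prod ?\<mu> \<sigma> {0..<n}"
    interpret prob_space ?M by (rule prob_space_gauss_prod[OF \<sigma>(1)])
    have \<mu>: "?\<mu> i = (if i \<in> K then profile S B i (k - 1) else 0)" for i
      using finK by (simp add: means_def dS nbhd_clique_graph k_def)
    have "9 / 10 \<le> measure ?M {y \<in> space ?M.
      (\<forall>j\<in>{1..2 * B}. \<bar>noise S n ?\<mu> y j\<bar> < real n / 200) \<and>
      (\<forall>j\<in>{q - 1..q + 2}. \<bar>noise S n ?\<mu> y j\<bar> < 4 * \<sigma> * sqrt (real n))}"
      using q by (intro prob_small_noise n m \<sigma>) auto
    also have "\<dots> \<le> measure ?M {y \<in> space ?M. estimate S n B y \<in> {x. \<bar>x - real k\<bar> \<le> w}}"
    proof (intro finite_measure_mono subsetI CollectI; (elim CollectE conjE)?)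
      fix y assume y: "y \<in> space ?M" "\<forall>j\<in>{1..2 * B}. \<bar>noise S n ?\<mu> y j\<bar> < real n / 200"
        "\<forall>j\<in>{q - 1..q + 2}. \<bar>noise S n ?\<mu> y j\<bar> < 4 * \<sigma> * sqrt (real n)"
      have "\<bar>estimate S n B y - real (card K)\<bar>
          \<le> (real B + 2 * (10 * sqrt (real n) + 4 * \<sigma> * sqrt (real n))) / real q"
        using K k q n0 \<mu> that(2) y(2,3) unfolding k_def
        by (intro estimate_error[where r = r and \<mu> = ?\<mu>]) auto
      then show "y \<in> space ?M \<and> estimate S n B y \<in> {x. \<bar>x - real k\<bar> \<le> w}"
        using err y(1) by (simp add: k_def)
    next
      show "{y \<in> space ?M. estimate S n B y \<in> {x. \<bar>x - real k\<bar> \<le> w}} \<in> sets ?M"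
        using Y by measurable
    qed
    also have "\<dots> = ?f (set_encode S)"
      unfolding measure_alg_out[OF \<sigma>(1) n0 Y] dS ..
    finally show ?thesis .
  qed
  have "2 / 3 \<le> 9 / 10 * (9 / 10 :: real)" by simp
  also have "\<dots> \<le> 9 / 10 * measure_pmf.prob ?p {S. well_spread n (2 * B) K q S}"
    using prob_well_spread[OF n m K(1) q] by simp
  also have "\<dots> = measure_pmf.expectation ?p (\<lambda>S. 9 / 10 * indicator {S. well_spread n (2 * B) K q S} S)"
    by simp
  also have "\<dots> \<le> measure_pmf.expectation ?p (\<lambda>S. ?f (set_encode S))"
    using good by (intro integral_mono_AE integrable_measure_pmf_finite fin)
      (auto simp: AE_measure_pmf_iff indicator_def)
  also have "\<dots> = alg_prob n (map_pmf set_encode ?p) (randomizer B \<sigma>) (postprocess n B) (clique_graph K) {x. \<bar>x - real k\<bar> \<le> w}"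
    by (simp add: alg_prob_def)
  finally show ?thesis .
qed

theorem theorem4p9:
  shows "\<exists>(c::real) (C::real) (n0::nat). c > 0 \<and> C > 0 \<and>
    (\<forall>n \<ge> n0. \<forall>\<delta> \<epsilon> :: real.
       0 < \<delta> \<and> \<delta> \<le> 1/2 \<and> 0 < \<epsilon> \<and> \<epsilon> \<le> 1 \<and>
       \<epsilon> \<ge> c * sqrt (ln (real n) * ln (1/\<delta>) / real n) \<longrightarrow>
       (\<exists>\<rho> R P. is_LNDP n \<epsilon> \<delta> \<rho> R P \<and>
          (\<forall>K. K \<subseteq> {0..<n} \<and> real (card K) \<ge> real n / 10 \<longrightarrow>
             alg_prob n \<rho> R P (clique_graph K)
               {x. \<bar>x - real (card K)\<bar> \<le> C * sqrt (ln (1/\<delta>)) / \<epsilon>} \<ge> 2/3)))"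
\<comment> \<open>The value \<open>10 ^ 15\<close> ensures \<open>sqrt n \<ge> 2 * 10 ^ 7\<close>.
  The value 2400 satisfies \<open>2400\<^sup>2 \<ge> 64 * 80000\<close>, as the noise condition
  demands. For 5000: \<open>\<epsilon> \<le> 2 * sqrt l\<close> turns
  \<open>880 + 320 * \<sigma>\<close> into at most
  \<open>(1760 + 2560) * sqrt l / \<epsilon>\<close>.\<close>
proof (rule exI[of _ 2400], rule exI[of _ 5000], rule exI[of _ "10 ^ 15"], intro conjI allI impI; (elim conjE)?)
  show "(2400::real) > 0" "(5000::real) > 0" by simp_all
  fix n :: nat and \<delta> \<epsilon> :: real
  assume n: "n \<ge> 10 ^ 15" and \<delta>: "0 < \<delta>" "\<delta> \<le> 1/2" and \<epsilon>: "0 < \<epsilon>" "\<epsilon> \<le> 1"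
    and c: "\<epsilon> \<ge> 2400 * sqrt (ln (real n) * ln (1/\<delta>) / real n)"
  define l where "l = ln (1/\<delta>)"
  define \<sigma> where "\<sigma> = 8 * sqrt l / \<epsilon>"
  define B where "B = nat \<lceil>sqrt (real n)\<rceil>"
  have l: "l \<ge> 1/2" unfolding l_def by (rule ln_inverse_ge_half[OF \<delta>])
  have n': "real n \<ge> 10 ^ 15"
    using n by (metis of_nat_le_iff of_nat_numeral of_nat_power)
  have s: "sqrt (real n) \<ge> 2 * 10 ^ 7"
    using n' by (intro real_le_rsqrt) simp
  have n0: "n > 0" using n by (cases n) auto
  have \<sigma>: "\<sigma> > 0" "\<sigma>\<^sup>2 = 64 * ln (1/\<delta>) / \<epsilon>\<^sup>2"
    using l \<epsilon> by (auto simp: \<sigma>_def power_mult_distrib power_divide simp flip: l_def)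
  have B: "sqrt (real n) \<le> real B" "real B \<le> 2 * sqrt (real n)"
  proof -
    show "sqrt (real n) \<le> real B" unfolding B_def by (rule real_nat_ceiling_ge)
    have "real B \<le> sqrt (real n) + 1"
      using of_int_ceiling_le_add_one[of "sqrt (real n)"] by (simp add: B_def)
    then show "real B \<le> 2 * sqrt (real n)" using s by simp
  qed
  have B2: "B > 0" "real n \<le> (real B)\<^sup>2"
    using B s power_mono[OF B(1), of 2] by (auto intro: Nat.gr0I)
  have ln0: "ln (real n) \<ge> 0" using n' by simp
  have "(2400 * sqrt (ln (real n) * l / real n))\<^sup>2 \<le> \<epsilon>\<^sup>2"
    using c ln0 l by (intro power_mono) (auto simp: l_def)
  then have "2400\<^sup>2 * (ln (real n) * l / real n) \<le> \<epsilon>\<^sup>2"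
    using ln0 l by (simp add: power_mult_distrib)
  then have "2400\<^sup>2 * (ln (real n) * l) \<le> \<epsilon>\<^sup>2 * real n"
    using n0 by (simp add: field_simps)
  moreover have "ln (real n) * l \<ge> 0" using ln0 l by simp
  \<comment> \<open>The number is \<open>64 * 80000\<close>, with 64 coming from
    \<open>\<sigma>\<^sup>2\<close>.\<close>
  ultimately have "5120000 * (ln (real n) * l) \<le> \<epsilon>\<^sup>2 * real n" by simp
  then have \<sigma>n: "80000 * \<sigma>\<^sup>2 * ln (real n) \<le> real n"
    using \<epsilon> unfolding \<sigma>(2) l_def[symmetric] by (simp add: field_simps)
  have w: "880 + 320 * \<sigma> \<le> 5000 * sqrt (ln (1/\<delta>)) / \<epsilon>"
  proof -
    have "1 / 2 \<le> sqrt l" using l by (intro real_le_rsqrt) (simp add: power2_eq_square)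
    then have "\<epsilon> \<le> 2 * sqrt l" using \<epsilon> by linarith
    then show ?thesis using \<epsilon> by (simp add: \<sigma>_def l_def field_simps)
  qed
  let ?\<rho> = "map_pmf set_encode (pmf_of_set (Pow (prod_encode ` ({0..<n} \<times> {0..2 * B}))))"
  show "\<exists>\<rho> R P. is_LNDP n \<epsilon> \<delta> \<rho> R P \<and>
          (\<forall>K. K \<subseteq> {0..<n} \<and> real (card K) \<ge> real n / 10 \<longrightarrow>
             alg_prob n \<rho> R P (clique_graph K)
               {x. \<bar>x - real (card K)\<bar> \<le> 5000 * sqrt (ln (1/\<delta>)) / \<epsilon>} \<ge> 2/3)"
    using is_LNDP_randomizer[OF \<epsilon> \<delta> B2 n0 \<sigma>, of ?\<rho>] alg_prob_clique[OF s B _ _ \<sigma>(1) \<sigma>n w]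
    by blast
qed

end
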